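(* Let $(P;\oplus,0,1)$ be a lattice pseudo-effect algebra with its induced partial order $\le$ and complements ${}^-,{}^{\sim}$. Define $a\circ b:=(a\wedge b^-)/ a$ and $a\ast b:=a\backslash(a\wedge b^{\sim})$ for all $a,b\in P$. Then $(P;{}^-,{}^{\sim},\circ,\ast,0,1)$ is a pseudo Sasaki algebra.
   Context: A pseudo-effect algebra (PEA) is a partial algebra $(P;\oplus,0,1)$, with $\oplus$ a partial binary operation and $0,1$ constants, such that for all $a,b,c\in P$: (PE1) $a\oplus b$ and $(a\oplus b)\oplus c$ exist iff $b\oplus c$ and $a\oplus(b\oplus c)$ exist, and in this case $(a\oplus b)\oplus c=a\oplus(b\oplus c)$; (PE2) there exist exactly one $d\in P$ and exactly one $e\in P$ with $a\oplus d=e\oplus a=1$; (PE3) if $a\oplus b$ exists, there are $d,e\in P$ with $a\oplus b=d\oplus a=b\oplus e$; (PE4) if $a\oplus 1$ or $1\oplus a$ exists, then $a=0$. The partial order is: $a\le b$ iff $c\oplus a=b$ for some $c\in P$, equivalently iff $a\oplus d=b$ for some $d\in P$. For $a\le b$, $b\backslash a$ is the element $x$ with $b=x\oplus a$, and $a/ b$ is the element $y$ with $b=a\oplus y$ (these are unique). Complements: $a^-:=1\backslash a$ and $a^{\sim}:=a/ 1$, so $a^-\oplus a=1=a\oplus a^{\sim}$. The sum $a\oplus b$ exists iff $a\le b^-$, equivalently iff $b\le a^{\sim}$. A lattice pseudo-effect algebra (LPEA) is a PEA that is a lattice under this order. A pseudo Sasaki algebra is a structure $(P;{}^-,{}^{\sim},\circ,\ast,0,1)$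 where $P$ is a bounded poset under $\le$ with least element $0$ and greatest element $1$, ${}^-,{}^{\sim}$ are unary operations and $\circ,\ast$ are (total) binary operations on $P$, satisfying for all $a,b,c\in P$: (1) $a^{-\sim}=a^{\sim -}=a$ (where $a^{-\sim}=(a^-)^{\sim}$, etc.), and $a\le b$ implies $b^-\le a^-$ and $b^{\sim}\le a^{\sim}$; (2) $a\circ 1=1\circ a=a=1\ast a=a\ast 1$; (3) $a\circ b\le c\iff a\ast c^-\le b^-$; and $a\ast b\le c\iff a\circ c^{\sim}\le b^{\sim}$; (4) $c\le a$ and $c\le b$ imply $c\le a\circ(a\ast b^-)^{\sim}=a\ast(a\circ b^{\sim})^-$; (5) $a\le b^-$ and $c\le a^{\sim}\circ b^{\sim}$ imply $(a^{\sim}\circ b^{\sim})\circ c^{\sim}=a^{\sim}\circ(b^{\sim}\circ c^{\sim})$; and $c\le b^{\sim}$ and $a\le c^-\ast b^-$ imply $c^-\ast(b^-\ast a^-)=(c^-\ast b^-)\ast a^-$; (6) $a\le b^-$ implies $(a^{\sim}\circ b^{\sim})^-=(b^-\ast a^-)^{\sim}$. *)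

theory Defs
  imports Main
begin

text \<open>
  The underlying set P is a whole type. The partial operation is option-valued:
  \<open>a \<oplus> b = Some x\<close> says that the sum exists and equals \<open>x\<close>, \<open>None\<close> that it does not exist.
  The derived notions live in a locale without assumptions; the descriptions
  below are meaningful (unique existence) under the axioms and side conditions where they are used.
\<close>

locale partial_sum_algebra =
  fixes oplus :: "'a \<Rightarrow> 'a \<Rightarrow> 'a option" (infixl \<open>\<oplus>\<close> 65)
    and zero :: 'a (\<open>\<zero>\<close>)
    and one :: 'a (\<open>\<one>\<close>)
begin

definition le :: "'a \<Rightarrow> 'a \<Rightarrow> bool" (infix \<open>\<preceq>\<close> 50)
  where "a \<preceq> b \<longleftrightarrow> (\<exists>c. c \<oplus> a = Some b)"

text \<open>\<open>ldiff b a\<close> is $b \backslash a$ and \<open>rdiff a b\<close> is $a / b$; both are intended for \<open>a \<preceq> b\<close>.\<close>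

definition ldiff :: "'a \<Rightarrow> 'a \<Rightarrow> 'a"
  where "ldiff b a = (THE x. x \<oplus> a = Some b)"

definition rdiff :: "'a \<Rightarrow> 'a \<Rightarrow> 'a"
  where "rdiff a b = (THE y. a \<oplus> y = Some b)"

definition lcompl :: "'a \<Rightarrow> 'a" (\<open>(_\<^sup>-)\<close> [1000] 999)
  where "a\<^sup>- = ldiff \<one> a"

definition rcompl :: "'a \<Rightarrow> 'a" (\<open>(_\<^sup>\<sim>)\<close> [1000] 999)
  where "a\<^sup>\<sim> = rdiff a \<one>"

definition is_glb :: "'a \<Rightarrow> 'a \<Rightarrow> 'a \<Rightarrow> bool"
  where "is_glb m a b \<longleftrightarrow> m \<preceq> a \<and> m \<preceq> b \<and> (\<forall>x. x \<preceq> a \<and> x \<preceq> b \<longrightarrow> x \<preceq> m)"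

definition is_lub :: "'a \<Rightarrow> 'a \<Rightarrow> 'a \<Rightarrow> bool"
  where "is_lub j a b \<longleftrightarrow> a \<preceq> j \<and> b \<preceq> j \<and> (\<forall>x. a \<preceq> x \<and> b \<preceq> x \<longrightarrow> j \<preceq> x)"

definition meet :: "'a \<Rightarrow> 'a \<Rightarrow> 'a" (infixl \<open>\<sqinter>\<close> 70)
  where "a \<sqinter> b = (THE m. is_glb m a b)"

definition sasaki_circ :: "'a \<Rightarrow> 'a \<Rightarrow> 'a"
  where "sasaki_circ a b = rdiff (a \<sqinter> b\<^sup>-) a"

definition sasaki_ast :: "'a \<Rightarrow> 'a \<Rightarrow> 'a"
  where "sasaki_ast a b = ldiff a (a \<sqinter> b\<^sup>\<sim>)"

end

text \<open>
  In (PE1) the equivalence is required for every value \<open>s\<close>, which expresses both the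
  equivalence of the two existence statements and the equality of the sums.
\<close>

locale pseudo_effect_algebra = partial_sum_algebra +
  assumes PE1: "(\<exists>x. a \<oplus> b = Some x \<and> x \<oplus> c = Some s) \<longleftrightarrow>
                (\<exists>y. b \<oplus> c = Some y \<and> a \<oplus> y = Some s)"
    and PE2: "(\<exists>!d. a \<oplus> d = Some \<one>) \<and> (\<exists>!e. e \<oplus> a = Some \<one>)"
    and PE3: "a \<oplus> b = Some s \<Longrightarrow> (\<exists>d e. d \<oplus> a = Some s \<and> b \<oplus> e = Some s)"
    and PE4: "a \<oplus> \<one> \<noteq> None \<or> \<one> \<oplus> a \<noteq> None \<Longrightarrow> a = \<zero>"

text \<open>
  That \<open>\<preceq>\<close> is a partial order follows from the axioms of a pseudo-effect algebra,
  so being a lattice is the existence of binary infima and suprema.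
\<close>

locale lattice_pseudo_effect_algebra = pseudo_effect_algebra +
  assumes glb_exists: "\<exists>m. is_glb m a b"
    and lub_exists: "\<exists>j. is_lub j a b"

locale pseudo_sasaki_algebra =
  fixes le :: "'a \<Rightarrow> 'a \<Rightarrow> bool" (infix \<open>\<preceq>\<close> 50)
    and lcompl :: "'a \<Rightarrow> 'a" (\<open>(_\<^sup>-)\<close> [1000] 999)
    and rcompl :: "'a \<Rightarrow> 'a" (\<open>(_\<^sup>\<sim>)\<close> [1000] 999)
    and circ :: "'a \<Rightarrow> 'a \<Rightarrow> 'a" (infix \<open>\<odot>\<close> 70)
    and ast :: "'a \<Rightarrow> 'a \<Rightarrow> 'a" (infix \<open>\<star>\<close> 70)
    and zero :: 'a (\<open>\<zero>\<close>)
    and one :: 'a (\<open>\<one>\<close>)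
  assumes partial_order: "reflp (\<preceq>)" "transp (\<preceq>)" "antisymp (\<preceq>)"
    and bounded: "\<zero> \<preceq> a" "a \<preceq> \<one>"
    and PS1_invol: "(a\<^sup>-)\<^sup>\<sim> = a" "(a\<^sup>\<sim>)\<^sup>- = a"
    and PS1_antitone: "a \<preceq> b \<Longrightarrow> b\<^sup>- \<preceq> a\<^sup>-" "a \<preceq> b \<Longrightarrow> b\<^sup>\<sim> \<preceq> a\<^sup>\<sim>"
    and PS2: "a \<odot> \<one> = a" "\<one> \<odot> a = a" "\<one> \<star> a = a" "a \<star> \<one> = a"
    and PS3: "a \<odot> b \<preceq> c \<longleftrightarrow> a \<star> c\<^sup>- \<preceq> b\<^sup>-"
             "a \<star> b \<preceq> c \<longleftrightarrow> a \<odot> c\<^sup>\<sim> \<preceq> b\<^sup>\<sim>"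
    and PS4: "c \<preceq> a \<Longrightarrow> c \<preceq> b \<Longrightarrow>
                c \<preceq> a \<odot> (a \<star> b\<^sup>-)\<^sup>\<sim> \<and> a \<odot> (a \<star> b\<^sup>-)\<^sup>\<sim> = a \<star> (a \<odot> b\<^sup>\<sim>)\<^sup>-"
    and PS5: "a \<preceq> b\<^sup>- \<Longrightarrow> c \<preceq> a\<^sup>\<sim> \<odot> b\<^sup>\<sim> \<Longrightarrow>
                (a\<^sup>\<sim> \<odot> b\<^sup>\<sim>) \<odot> c\<^sup>\<sim> = a\<^sup>\<sim> \<odot> (b\<^sup>\<sim> \<odot> c\<^sup>\<sim>)"
             "c \<preceq> b\<^sup>\<sim> \<Longrightarrow> a \<preceq> c\<^sup>- \<star> b\<^sup>- \<Longrightarrow>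
                c\<^sup>- \<star> (b\<^sup>- \<star> a\<^sup>-) = (c\<^sup>- \<star> b\<^sup>-) \<star> a\<^sup>-"
    and PS6: "a \<preceq> b\<^sup>- \<Longrightarrow> (a\<^sup>\<sim> \<odot> b\<^sup>\<sim>)\<^sup>- = (b\<^sup>- \<star> a\<^sup>-)\<^sup>\<sim>"

end

theory Submission
  imports Defs
begin

text \<open>
  Two observations carry the proof. The first concerns a fixed element \<open>a\<close>: in the
  decompositions \<open>x \<oplus> y = a\<close> each part determines the other, and enlarging one part
  shrinks the other (\<open>summand_antitone\<close>). Sasaki's operations read off such complementary
  parts, \<open>(a \<sqinter> b\<^sup>-) \<oplus> (a \<circ> b) = a\<close> and \<open>(a \<ast> b) \<oplus> (a \<sqinter> b\<^sup>\<sim>) = a\<close>, so the adjointness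
  of \<open>\<circ>\<close> and \<open>\<ast>\<close> is exactly this antitone correspondence below \<open>a\<close>: since \<open>a \<circ> b\<close> always
  lies below \<open>a\<close>, it lies below \<open>c\<close> iff it lies below \<open>a \<sqinter> c\<close>, and passing to the
  complementary parts turns this into a statement about \<open>a \<ast> c\<^sup>-\<close>. The same complementation
  applied twice returns \<open>a \<sqinter> b\<close>, which is the Sasaki form of the meet.

  The second observation is that on summable elements the operations are the De Morgan
  duals of \<open>\<oplus>\<close>: if \<open>a \<oplus> b = s\<close> then \<open>a\<^sup>\<sim> \<circ> b\<^sup>\<sim> = s\<^sup>\<sim>\<close> and \<open>b\<^sup>- \<ast> a\<^sup>- = s\<^sup>-\<close>, because
  the meet in the definition collapses. The conditional associativity laws for \<open>\<circ>\<close> and \<open>\<ast>\<close>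
  are then the associativity of \<open>\<oplus>\<close>.
\<close>

section \<open>Sums, order and complements in pseudo-effect algebras\<close>

context pseudo_effect_algebra
begin

lemma sum_assoc_right:
  "a \<oplus> b = Some x \<Longrightarrow> x \<oplus> c = Some s \<Longrightarrow> \<exists>y. b \<oplus> c = Some y \<and> a \<oplus> y = Some s"
  using PE1 by blast

lemma sum_assoc_left:
  "b \<oplus> c = Some y \<Longrightarrow> a \<oplus> y = Some s \<Longrightarrow> \<exists>x. a \<oplus> b = Some x \<and> x \<oplus> c = Some s"
  using PE1 by blast

text \<open>
  Cancellation is inherited from the uniqueness of complements: extend both sums by the
  same element so that the total becomes \<open>\<one>\<close>.
\<close>

lemma cancel_left:
  assumes "a \<oplus> b = Some s" "a \<oplus> c = Some s"
  shows "b = c"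
proof -
  obtain e where e: "e \<oplus> s = Some \<one>"
    using PE2 by blast
  obtain x where x: "e \<oplus> a = Some x" "x \<oplus> b = Some \<one>"
    using sum_assoc_left[OF assms(1) e] by blast
  moreover have "x \<oplus> c = Some \<one>"
    using sum_assoc_left[OF assms(2) e] x(1) by auto
  ultimately show ?thesis
    using PE2 by blast
qed

lemma cancel_right:
  assumes "b \<oplus> a = Some s" "c \<oplus> a = Some s"
  shows "b = c"
proof -
  obtain d where d: "s \<oplus> d = Some \<one>"
    using PE2 by blast
  obtain x where x: "a \<oplus> d = Some x" "b \<oplus> x = Some \<one>"
    using sum_assoc_right[OF assms(1) d] by blast
  moreover have "c \<oplus> x = Some \<one>"
    using sum_assoc_right[OF assms(2) d] x(1) by auto
  ultimately show ?thesis
    using PE2 by blast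
qed

lemma one_plus_zero: "\<one> \<oplus> \<zero> = Some \<one>"
  using PE2[of \<one>] PE4 by (metis option.distinct(1))

lemma zero_plus_one: "\<zero> \<oplus> \<one> = Some \<one>"
  using PE2[of \<one>] PE4 by (metis option.distinct(1))

lemma zero_plus: "\<zero> \<oplus> a = Some a"
proof -
  obtain d where d: "a \<oplus> d = Some \<one>"
    using PE2 by blast
  obtain x where "\<zero> \<oplus> a = Some x" "x \<oplus> d = Some \<one>"
    using sum_assoc_left[OF d zero_plus_one] by blast
  with cancel_right[OF _ d] show ?thesis
    by blast
qed

lemma plus_zero: "a \<oplus> \<zero> = Some a"
proof -
  obtain e where e: "e \<oplus> a = Some \<one>"
    using PE2 by blast
  obtain x where "a \<oplus> \<zero> = Some x" "e \<oplus> x = Some \<one>"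
    using sum_assoc_right[OF e one_plus_zero] by blast
  with cancel_left[OF _ e] show ?thesis
    by blast
qed

text \<open>The axiom \<open>PE3\<close> moves a summand to the other side, in both directions.\<close>

lemma le_iff_right_summand: "a \<preceq> b \<longleftrightarrow> (\<exists>d. a \<oplus> d = Some b)"
  unfolding le_def using PE3 by blast

lemma le_refl: "a \<preceq> a"
  unfolding le_def using zero_plus by blast

lemma le_trans: "a \<preceq> b \<Longrightarrow> b \<preceq> c \<Longrightarrow> a \<preceq> c"
  unfolding le_def using sum_assoc_left by blast

lemma left_summand_of_zero:
  assumes "a \<oplus> b = Some \<zero>"
  shows "a = \<zero>"
proof -
  have "\<one> \<oplus> a \<noteq> None"
    using sum_assoc_left[OF assms one_plus_zero] by auto
  then show ?thesis
    using PE4 by blast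
qed

lemma le_antisym:
  assumes "a \<preceq> b" "b \<preceq> a"
  shows "a = b"
proof -
  obtain c d where c: "c \<oplus> a = Some b" and d: "d \<oplus> b = Some a"
    using assms unfolding le_def by blast
  obtain x where "d \<oplus> c = Some x" "x \<oplus> a = Some a"
    using sum_assoc_left[OF c d] by blast
  with cancel_right[OF _ zero_plus] have "d \<oplus> c = Some \<zero>"
    by blast
  then have "d = \<zero>"
    by (rule left_summand_of_zero)
  with d zero_plus show ?thesis
    by simp
qed

lemma zero_le: "\<zero> \<preceq> a"
  unfolding le_def using plus_zero by blast

lemma le_one: "a \<preceq> \<one>"
  unfolding le_def using PE2 by blast

text \<open>
  Writing \<open>x' = x \<oplus> d\<close>, the two decompositions of \<open>a\<close> read \<open>x \<oplus> y\<close> and \<open>x \<oplus> (d \<oplus> y')\<close>;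
  the element \<open>d\<close> has migrated from the left part to the right part.
\<close>

lemma summand_antitone:
  assumes xy: "x \<oplus> y = Some a" and xy': "x' \<oplus> y' = Some a"
  shows "x \<preceq> x' \<longleftrightarrow> y' \<preceq> y"
proof
  assume "x \<preceq> x'"
  then obtain d where d: "x \<oplus> d = Some x'"
    unfolding le_iff_right_summand by blast
  obtain z where "d \<oplus> y' = Some z" "x \<oplus> z = Some a"
    using sum_assoc_right[OF d xy'] by blast
  with cancel_left[OF _ xy] show "y' \<preceq> y"
    unfolding le_def by blast
next
  assume "y' \<preceq> y"
  then obtain d where d: "d \<oplus> y' = Some y"
    unfolding le_def by blast
  obtain z where "x \<oplus> d = Some z" "z \<oplus> y' = Some a"
    using sum_assoc_left[OF d xy] by blast
  with cancel_right[OF _ xy'] show "x \<preceq> x'"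
    unfolding le_iff_right_summand by blast
qed

lemma ldiff_eqI: "x \<oplus> a = Some b \<Longrightarrow> ldiff b a = x"
  unfolding ldiff_def using cancel_right by blast

lemma rdiff_eqI: "a \<oplus> y = Some b \<Longrightarrow> rdiff a b = y"
  unfolding rdiff_def using cancel_left by blast

lemma ldiff_plus: "a \<preceq> b \<Longrightarrow> ldiff b a \<oplus> a = Some b"
  unfolding le_def using ldiff_eqI by blast

lemma plus_rdiff: "a \<preceq> b \<Longrightarrow> a \<oplus> rdiff a b = Some b"
  unfolding le_iff_right_summand using rdiff_eqI by blast

lemma lcompl_plus: "a\<^sup>- \<oplus> a = Some \<one>"
  unfolding lcompl_def by (rule ldiff_plus[OF le_one])

lemma plus_rcompl: "a \<oplus> a\<^sup>\<sim> = Some \<one>"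
  unfolding rcompl_def by (rule plus_rdiff[OF le_one])

lemma lcompl_eqI: "x \<oplus> a = Some \<one> \<Longrightarrow> a\<^sup>- = x"
  unfolding lcompl_def by (rule ldiff_eqI)

lemma rcompl_eqI: "a \<oplus> x = Some \<one> \<Longrightarrow> a\<^sup>\<sim> = x"
  unfolding rcompl_def by (rule rdiff_eqI)

lemma rcompl_lcompl [simp]: "(a\<^sup>-)\<^sup>\<sim> = a"
  by (rule rcompl_eqI[OF lcompl_plus])

lemma lcompl_rcompl [simp]: "(a\<^sup>\<sim>)\<^sup>- = a"
  by (rule lcompl_eqI[OF plus_rcompl])

lemma lcompl_one [simp]: "\<one>\<^sup>- = \<zero>"
  by (rule lcompl_eqI[OF zero_plus_one])

lemma rcompl_one [simp]: "\<one>\<^sup>\<sim> = \<zero>"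
  by (rule rcompl_eqI[OF one_plus_zero])

lemma lcompl_antitone: "a \<preceq> b \<Longrightarrow> b\<^sup>- \<preceq> a\<^sup>-"
  using summand_antitone[OF lcompl_plus lcompl_plus] by blast

lemma rcompl_antitone: "a \<preceq> b \<Longrightarrow> b\<^sup>\<sim> \<preceq> a\<^sup>\<sim>"
  using summand_antitone[OF plus_rcompl plus_rcompl] by blast

text \<open>
  If \<open>a \<oplus> b = s\<close>, then splitting \<open>a \<oplus> b \<oplus> s\<^sup>\<sim> = \<one>\<close> after \<open>a\<close> shows that \<open>s\<^sup>\<sim>\<close> is what
  \<open>b\<close> lacks to \<open>a\<^sup>\<sim>\<close>; dually on the left.
\<close>

lemma plus_rcompl_sum:
  assumes "a \<oplus> b = Some s"
  shows "b \<oplus> s\<^sup>\<sim> = Some (a\<^sup>\<sim>)"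
proof -
  obtain y where "b \<oplus> s\<^sup>\<sim> = Some y" "a \<oplus> y = Some \<one>"
    using sum_assoc_right[OF assms plus_rcompl] by blast
  with rcompl_eqI show ?thesis
    by simp
qed

lemma lcompl_sum_plus:
  assumes "a \<oplus> b = Some s"
  shows "s\<^sup>- \<oplus> a = Some (b\<^sup>-)"
proof -
  obtain x where "s\<^sup>- \<oplus> a = Some x" "x \<oplus> b = Some \<one>"
    using sum_assoc_left[OF assms lcompl_plus] by blast
  with lcompl_eqI show ?thesis
    by simp
qed

lemma sum_exists_iff_le_lcompl: "(\<exists>s. a \<oplus> b = Some s) \<longleftrightarrow> a \<preceq> b\<^sup>-"
proof
  assume "\<exists>s. a \<oplus> b = Some s"
  then show "a \<preceq> b\<^sup>-"
    unfolding le_def using lcompl_sum_plus by blast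
next
  assume "a \<preceq> b\<^sup>-"
  then obtain c where c: "c \<oplus> a = Some (b\<^sup>-)"
    unfolding le_def by blast
  show "\<exists>s. a \<oplus> b = Some s"
    using sum_assoc_right[OF c lcompl_plus] by blast
qed

lemma sum_exists_iff_le_rcompl: "(\<exists>s. a \<oplus> b = Some s) \<longleftrightarrow> b \<preceq> a\<^sup>\<sim>"
proof
  assume "\<exists>s. a \<oplus> b = Some s"
  then show "b \<preceq> a\<^sup>\<sim>"
    unfolding le_iff_right_summand using plus_rcompl_sum by blast
next
  assume "b \<preceq> a\<^sup>\<sim>"
  then obtain d where d: "b \<oplus> d = Some (a\<^sup>\<sim>)"
    unfolding le_iff_right_summand by blast
  show "\<exists>s. a \<oplus> b = Some s"
    using sum_assoc_left[OF d plus_rcompl] by blast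
qed

end

section \<open>The Sasaki operations\<close>

context lattice_pseudo_effect_algebra
begin

lemma meet_is_glb: "is_glb (a \<sqinter> b) a b"
proof -
  have "\<exists>!m. is_glb m a b"
    using glb_exists[of a b] le_antisym unfolding is_glb_def by blast
  then show ?thesis
    unfolding meet_def by (rule theI')
qed

lemma le_meet_iff: "x \<preceq> a \<sqinter> b \<longleftrightarrow> x \<preceq> a \<and> x \<preceq> b"
  using meet_is_glb[of a b] le_trans unfolding is_glb_def by blast

lemma meet_le1: "a \<sqinter> b \<preceq> a" and meet_le2: "a \<sqinter> b \<preceq> b"
  using le_meet_iff le_refl by blast+

lemma meet_absorb: "b \<preceq> a \<Longrightarrow> a \<sqinter> b = b"
  by (rule le_antisym) (simp_all add: meet_le2 le_meet_iff le_refl)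

lemma meet_plus_circ: "(a \<sqinter> b\<^sup>-) \<oplus> sasaki_circ a b = Some a"
  unfolding sasaki_circ_def by (rule plus_rdiff[OF meet_le1])

lemma ast_plus_meet: "sasaki_ast a b \<oplus> (a \<sqinter> b\<^sup>\<sim>) = Some a"
  unfolding sasaki_ast_def by (rule ldiff_plus[OF meet_le1])

lemma circ_eqI: "(a \<sqinter> b\<^sup>-) \<oplus> y = Some a \<Longrightarrow> sasaki_circ a b = y"
  unfolding sasaki_circ_def by (rule rdiff_eqI)

lemma ast_eqI: "x \<oplus> (a \<sqinter> b\<^sup>\<sim>) = Some a \<Longrightarrow> sasaki_ast a b = x"
  unfolding sasaki_ast_def by (rule ldiff_eqI)

lemma circ_le: "sasaki_circ a b \<preceq> a"
  unfolding le_def using meet_plus_circ by blast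

lemma ast_le: "sasaki_ast a b \<preceq> a"
  unfolding le_iff_right_summand using ast_plus_meet by blast

text \<open>
  Each side compares a Sasaki element with a meet below \<open>a\<close>, and the two comparisons are
  complementary in \<open>a\<close>.
\<close>

lemma circ_ast_adjoint: "sasaki_circ a b \<preceq> c \<longleftrightarrow> sasaki_ast a (c\<^sup>-) \<preceq> b\<^sup>-"
proof -
  have decomp: "sasaki_ast a (c\<^sup>-) \<oplus> (a \<sqinter> c) = Some a"
    using ast_plus_meet[of a "c\<^sup>-"] by simp
  have "sasaki_circ a b \<preceq> c \<longleftrightarrow> sasaki_circ a b \<preceq> a \<sqinter> c"
    using circ_le by (simp add: le_meet_iff)
  also have "\<dots> \<longleftrightarrow> sasaki_ast a (c\<^sup>-) \<preceq> a \<sqinter> b\<^sup>-"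
    using summand_antitone[OF decomp meet_plus_circ] by simp
  also have "\<dots> \<longleftrightarrow> sasaki_ast a (c\<^sup>-) \<preceq> b\<^sup>-"
    using ast_le by (simp add: le_meet_iff)
  finally show ?thesis .
qed

lemma ast_circ_adjoint: "sasaki_ast a b \<preceq> c \<longleftrightarrow> sasaki_circ a (c\<^sup>\<sim>) \<preceq> b\<^sup>\<sim>"
  using circ_ast_adjoint[of a "c\<^sup>\<sim>" "b\<^sup>\<sim>"] by simp

text \<open>
  The part \<open>a \<ast> b\<^sup>-\<close> is complementary in \<open>a\<close> to \<open>a \<sqinter> b\<close> and already lies below \<open>a\<close>, so taking
  the complementary part once more brings \<open>a \<sqinter> b\<close> back; likewise with the two operations exchanged.
\<close>

lemma circ_ast_eq_meet: "sasaki_circ a ((sasaki_ast a (b\<^sup>-))\<^sup>\<sim>) = a \<sqinter> b"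
  using ast_plus_meet[of a "b\<^sup>-"] meet_absorb[OF ast_le] by (intro circ_eqI) simp

lemma ast_circ_eq_meet: "sasaki_ast a ((sasaki_circ a (b\<^sup>\<sim>))\<^sup>-) = a \<sqinter> b"
  using meet_plus_circ[of a "b\<^sup>\<sim>"] meet_absorb[OF circ_le] by (intro ast_eqI) simp

text \<open>
  Summability of \<open>a\<close> and \<open>b\<close> means \<open>b \<preceq> a\<^sup>\<sim>\<close>, and equally \<open>a \<preceq> b\<^sup>-\<close>, so the meets in the
  definitions of \<open>a\<^sup>\<sim> \<circ> b\<^sup>\<sim>\<close> and \<open>b\<^sup>- \<ast> a\<^sup>-\<close> are \<open>b\<close> and \<open>a\<close>.
\<close>

lemma circ_rcompl_eq_rcompl_sum:
  assumes "a \<oplus> b = Some s"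
  shows "sasaki_circ (a\<^sup>\<sim>) (b\<^sup>\<sim>) = s\<^sup>\<sim>"
proof (rule circ_eqI)
  have "b \<preceq> a\<^sup>\<sim>"
    using assms sum_exists_iff_le_rcompl by blast
  then show "(a\<^sup>\<sim> \<sqinter> (b\<^sup>\<sim>)\<^sup>-) \<oplus> s\<^sup>\<sim> = Some (a\<^sup>\<sim>)"
    using plus_rcompl_sum[OF assms] by (simp add: meet_absorb)
qed

lemma ast_lcompl_eq_lcompl_sum:
  assumes "a \<oplus> b = Some s"
  shows "sasaki_ast (b\<^sup>-) (a\<^sup>-) = s\<^sup>-"
proof (rule ast_eqI)
  have "a \<preceq> b\<^sup>-"
    using assms sum_exists_iff_le_lcompl by blast
  then show "s\<^sup>- \<oplus> (b\<^sup>- \<sqinter> (a\<^sup>-)\<^sup>\<sim>) = Some (b\<^sup>-)"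
    using lcompl_sum_plus[OF assms] by (simp add: meet_absorb)
qed

text \<open>The hypotheses guarantee that the triple sum of \<open>a\<close>, \<open>b\<close>, \<open>c\<close> exists.\<close>

lemma circ_assoc:
  assumes ab: "a \<preceq> b\<^sup>-" and c: "c \<preceq> sasaki_circ (a\<^sup>\<sim>) (b\<^sup>\<sim>)"
  shows "sasaki_circ (sasaki_circ (a\<^sup>\<sim>) (b\<^sup>\<sim>)) (c\<^sup>\<sim>) =
         sasaki_circ (a\<^sup>\<sim>) (sasaki_circ (b\<^sup>\<sim>) (c\<^sup>\<sim>))"
proof -
  obtain s where s: "a \<oplus> b = Some s"
    using ab sum_exists_iff_le_lcompl by blast
  obtain t where t: "s \<oplus> c = Some t"
    using c sum_exists_iff_le_rcompl circ_rcompl_eq_rcompl_sum[OF s] by auto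
  obtain u where u: "b \<oplus> c = Some u" "a \<oplus> u = Some t"
    using sum_assoc_right[OF s t] by blast
  show ?thesis
    using s t u by (simp add: circ_rcompl_eq_rcompl_sum)
qed

lemma ast_assoc:
  assumes bc: "c \<preceq> b\<^sup>\<sim>" and a: "a \<preceq> sasaki_ast (c\<^sup>-) (b\<^sup>-)"
  shows "sasaki_ast (c\<^sup>-) (sasaki_ast (b\<^sup>-) (a\<^sup>-)) =
         sasaki_ast (sasaki_ast (c\<^sup>-) (b\<^sup>-)) (a\<^sup>-)"
proof -
  obtain u where u: "b \<oplus> c = Some u"
    using bc sum_exists_iff_le_rcompl by blast
  obtain t where t: "a \<oplus> u = Some t"
    using a sum_exists_iff_le_lcompl ast_lcompl_eq_lcompl_sum[OF u] by auto
  obtain s where s: "a \<oplus> b = Some s" "s \<oplus> c = Some t"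
    using sum_assoc_left[OF u t] by blast
  show ?thesis
    using s t u by (simp add: ast_lcompl_eq_lcompl_sum)
qed

lemma circ_one: "sasaki_circ a \<one> = a"
  using zero_plus[of a] meet_absorb[OF zero_le, of a] by (intro circ_eqI) simp

lemma ast_one: "sasaki_ast a \<one> = a"
  using plus_zero[of a] meet_absorb[OF zero_le, of a] by (intro ast_eqI) simp

lemma one_circ: "sasaki_circ \<one> a = a"
  using lcompl_plus[of a] meet_absorb[OF le_one, of "a\<^sup>-"] by (intro circ_eqI) simp

lemma one_ast: "sasaki_ast \<one> a = a"
  using plus_rcompl[of a] meet_absorb[OF le_one, of "a\<^sup>\<sim>"] by (intro ast_eqI) simp

lemma sasaki_operations_form_pseudo_sasaki_algebra:
  "pseudo_sasaki_algebra (\<preceq>) lcompl rcompl sasaki_circ sasaki_ast \<zero> \<one>"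
proof
  show "reflp (\<preceq>)" "transp (\<preceq>)" "antisymp (\<preceq>)"
    by (blast intro: reflpI transpI antisympI le_refl le_trans le_antisym)+
next
  fix a b c
  assume "c \<preceq> a" "c \<preceq> b"
  then show "c \<preceq> sasaki_circ a ((sasaki_ast a (b\<^sup>-))\<^sup>\<sim>) \<and>
      sasaki_circ a ((sasaki_ast a (b\<^sup>-))\<^sup>\<sim>) = sasaki_ast a ((sasaki_circ a (b\<^sup>\<sim>))\<^sup>-)"
    by (simp add: circ_ast_eq_meet ast_circ_eq_meet le_meet_iff)
next
  fix a b
  assume "a \<preceq> b\<^sup>-"
  then obtain s where "a \<oplus> b = Some s"
    using sum_exists_iff_le_lcompl by blast
  then show "(sasaki_circ (a\<^sup>\<sim>) (b\<^sup>\<sim>))\<^sup>- = (sasaki_ast (b\<^sup>-) (a\<^sup>-))\<^sup>\<sim>"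
    by (simp add: circ_rcompl_eq_rcompl_sum ast_lcompl_eq_lcompl_sum)
qed (fact zero_le le_one rcompl_lcompl lcompl_rcompl
    circ_one one_circ one_ast ast_one circ_ast_adjoint ast_circ_adjoint
  | (erule lcompl_antitone rcompl_antitone) | (erule (1) circ_assoc ast_assoc))+

end

theorem theorem4p4:
  fixes oplus :: "'a \<Rightarrow> 'a \<Rightarrow> 'a option" and zero one :: 'a
  assumes "lattice_pseudo_effect_algebra oplus zero one"
  shows "pseudo_sasaki_algebra
           (partial_sum_algebra.le oplus)
           (partial_sum_algebra.lcompl oplus one)
           (partial_sum_algebra.rcompl oplus one)
           (partial_sum_algebra.sasaki_circ oplus one)
           (partial_sum_algebra.sasaki_ast oplus one)
           zero one"
  using assms
  by (rule lattice_pseudo_effect_algebra.sasaki_operations_form_pseudo_sasaki_algebra)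

end
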